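(* For Colored Bin Packing with items of arbitrary sizes in $[0,1]$ and at least three colors, there is no deterministic online algorithm with asymptotic competitive ratio less than $2.5$.
   Context: Colored Bin Packing: items arrive as a sequence; each item has a size in $[0,1]$ and a color from a finite set $C$. A packing places items into unit-capacity bins, items in a bin ordered by arrival; it is valid if each bin has total size at most $1$ and no two consecutive items in a bin share a color. $\mathrm{OPT}(L)$ is the minimum number of bins in a valid packing of $L$ without reordering. An online algorithm must irrevocably place each item into an existing bin (respecting validity) or a new bin upon its arrival, without knowledge of future items; $\mathrm{ALG}(L)$ is the number of bins it uses. It is asymptotically $r$-competitive if $\mathrm{ALG}(L)\le r\cdot\mathrm{OPT}(L)+o(\mathrm{OPT}(L))$ for all $L$; the asymptotic competitive ratio is the infimum of such $r$. *)

theory Defs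
  imports Complex_Main "HOL-Library.Extended_Real" "HOL-Library.Landau_Symbols"
begin

type_synonym 'c item = "real \<times> 'c"

abbreviation item_size :: "'c item \<Rightarrow> real" where
  "item_size \<equiv> fst"

abbreviation item_color :: "'c item \<Rightarrow> 'c" where
  "item_color \<equiv> snd"

definition is_instance :: "'c set \<Rightarrow> 'c item list \<Rightarrow> bool" where
  "is_instance C L \<longleftrightarrow> (\<forall>x \<in> set L. 0 \<le> item_size x \<and> item_size x \<le> 1 \<and> item_color x \<in> C)"

text \<open>
  A packing of \<open>L\<close> is the list of the labels of the bins that receive the successive items of \<open>L\<close>.
  The labels themselves carry no meaning: an item opens a new bin iff its label has not
  occurred before.
\<close>

type_synonym packing = "nat list"

definition bin_contents :: "'c item list \<Rightarrow> packing \<Rightarrow> nat \<Rightarrow> 'c item list" where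
  "bin_contents L p b = map fst (filter (\<lambda>(x, b'). b' = b) (zip L p))"

definition valid_packing :: "'c item list \<Rightarrow> packing \<Rightarrow> bool" where
  "valid_packing L p \<longleftrightarrow> length p = length L \<and>
     (\<forall>b. sum_list (map item_size (bin_contents L p b)) \<le> 1 \<and>
          distinct_adj (map item_color (bin_contents L p b)))"

definition num_bins :: "packing \<Rightarrow> nat" where
  "num_bins p = card (set p)"

definition OPT :: "'c item list \<Rightarrow> nat" where
  "OPT L = (LEAST n. \<exists>p. valid_packing L p \<and> num_bins p = n)"

text \<open>
  A deterministic algorithm maps the items seen so far and the arriving item to the label of the
  bin receiving the latter. Its own earlier decisions are determined by the items seen so far,
  so they need not be passed to it.
\<close>

type_synonym 'c algorithm = "'c item list \<Rightarrow> 'c item \<Rightarrow> nat"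

definition run :: "'c algorithm \<Rightarrow> 'c item list \<Rightarrow> packing" where
  "run A L = map (\<lambda>i. A (take i L) (L ! i)) [0..<length L]"

definition online_algorithm :: "'c set \<Rightarrow> 'c algorithm \<Rightarrow> bool" where
  "online_algorithm C A \<longleftrightarrow> (\<forall>L. is_instance C L \<longrightarrow> valid_packing L (run A L))"

definition ALG :: "'c algorithm \<Rightarrow> 'c item list \<Rightarrow> nat" where
  "ALG A L = num_bins (run A L)"

definition asymptotically_competitive :: "'c set \<Rightarrow> 'c algorithm \<Rightarrow> real \<Rightarrow> bool" where
  "asymptotically_competitive C A r \<longleftrightarrow>
     (\<exists>g :: nat \<Rightarrow> real. g \<in> o(\<lambda>n. real n) \<and>
        (\<forall>L. is_instance C L \<longrightarrow> real (ALG A L) \<le> r * real (OPT L) + g (OPT L)))"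

text \<open>Extended reals make the ratio \<open>\<infinity>\<close> for an algorithm that is competitive for no \<open>r\<close>.\<close>

definition asymptotic_competitive_ratio :: "'c set \<Rightarrow> 'c algorithm \<Rightarrow> ereal" where
  "asymptotic_competitive_ratio C A = Inf {ereal r | r. asymptotically_competitive C A r}"

end

theory Submission
  imports Defs
begin

text \<open>
  Call a bin topped by \<open>c\<close> if its last item has color \<open>c\<close>. With three colors, \<open>n\<close> items of size zero
  in the color \<open>c\<close> that tops most of the algorithm's \<open>D\<close> bins leave it with at least \<open>n + D / 3\<close>
  bins topped by \<open>c\<close>; iterating, about \<open>3 n / 2\<close> bins topped by a single color. Between the rounds, pairs of items
  in the other two colors are sent: an optimal packing either collects them in one extra bin or uses them
  to hide the top color of its \<open>n\<close> bins, so it needs only one new bin per round.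

  In the last round the paired items get tiny positive sizes, chosen adaptively so that the items put by
  the algorithm into bins not touched before in this round are more than twice as large as all the others.
  The optimal packing hides its \<open>n\<close> tops with the smaller ones and collects the rest in one bin, so it can
  still take \<open>n\<close> huge items of the top color. None of the algorithm's \<open>3 n / 2\<close> bins can: each of them is
  still topped by that color or contains one of the larger items.
\<close>

section \<open>Bins and runs\<close>

lemma bin_contents_append:
  assumes "length p = length L"
  shows "bin_contents (L @ L') (p @ p') b = bin_contents L p b @ bin_contents L' p' b"
  using assms by (simp add: bin_contents_def)

lemma bin_contents_Nil [simp]: "bin_contents [] p b = []"
  by (simp add: bin_contents_def)

lemma bin_contents_Cons [simp]:
  "bin_contents (x # L) (l # p) b = (if l = b then [x] else []) @ bin_contents L p b"
  by (simp add: bin_contents_def)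

lemma set_bin_contents: "set (bin_contents L p b) \<subseteq> set L"
  by (auto simp: bin_contents_def dest: set_zip_leftD)

lemma length_bin_contents: "length (bin_contents L p b) \<le> length L"
  unfolding bin_contents_def
  by (metis (no_types, lifting) length_filter_le length_map length_zip min.cobounded1 order_trans)

lemma bin_contents_eq_Nil_iff:
  assumes "length p = length L"
  shows "bin_contents L p b = [] \<longleftrightarrow> b \<notin> set p"
  using assms by (induction p L rule: list_induct2) auto

lemma length_run [simp]: "length (run A L) = length L"
  by (simp add: run_def)

lemma run_snoc: "run A (L @ [x]) = run A L @ [A L x]"
  by (simp add: run_def nth_append)

lemma set_run_snoc: "set (run A (L @ [x])) = insert (A L x) (set (run A L))"
  by (simp add: run_snoc)

lemma set_run_append: "set (run A L) \<subseteq> set (run A (L @ L'))"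
proof (induction L' rule: rev_induct)
  case (snoc x L')
  then show ?case using run_snoc[of A "L @ L'" x] by auto
qed simp

abbreviation alg_bin :: "'c algorithm \<Rightarrow> 'c item list \<Rightarrow> nat \<Rightarrow> 'c item list" where
  "alg_bin A L b \<equiv> bin_contents L (run A L) b"

abbreviation level :: "'c item list \<Rightarrow> real" where
  "level X \<equiv> sum_list (map item_size X)"

lemma alg_bin_snoc: "alg_bin A (L @ [x]) b = alg_bin A L b @ (if A L x = b then [x] else [])"
  by (simp add: run_snoc bin_contents_append)

lemma alg_bin_eq_Nil_iff: "alg_bin A L b = [] \<longleftrightarrow> b \<notin> set (run A L)"
  by (simp add: bin_contents_eq_Nil_iff)

lemma is_instance_append [simp]: "is_instance C (L @ L') \<longleftrightarrow> is_instance C L \<and> is_instance C L'"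
  by (auto simp: is_instance_def)

lemma alg_bin_valid:
  assumes "online_algorithm C A" "is_instance C L"
  shows "level (alg_bin A L b) \<le> 1" "distinct_adj (map item_color (alg_bin A L b))"
  using assms by (auto simp: online_algorithm_def valid_packing_def)

lemma level_alg_bin_nonneg:
  assumes "is_instance C L"
  shows "0 \<le> level (alg_bin A L b)"
  using assms set_bin_contents[of L "run A L" b]
  by (intro sum_list_nonneg) (auto simp: is_instance_def)

lemma OPT_le:
  assumes "valid_packing L p" "set p \<subseteq> {..<m}"
  shows "OPT L \<le> m"
proof -
  have "OPT L \<le> num_bins p"
    unfolding OPT_def using assms(1) by (intro Least_le) blast
  also have "\<dots> \<le> m"
    unfolding num_bins_def using card_mono[OF _ assms(2)] by simp
  finally show ?thesis .
qed

section \<open>Blocked bins\<close>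

text \<open>The bins that cannot accept \<open>x\<close>. No level exceeds 1 in a valid run, so for
  an item of size zero they are exactly the bins topped by its color; for a huge item the bins that
  are too full count as well.\<close>

definition blocked :: "'c algorithm \<Rightarrow> 'c item \<Rightarrow> 'c item list \<Rightarrow> nat set" where
  "blocked A x L = {b \<in> set (run A L).
     item_color (last (alg_bin A L b)) = item_color x \<or> level (alg_bin A L b) + item_size x > 1}"

lemma finite_blocked [simp]: "finite (blocked A x L)"
  by (simp add: blocked_def)

lemma card_blocked_le_ALG: "card (blocked A x L) \<le> ALG A L"
  unfolding ALG_def num_bins_def by (rule card_mono) (auto simp: blocked_def)

lemma blocked_not_used:
  assumes "online_algorithm C A" "is_instance C (L @ [x])"
  shows "A L x \<notin> blocked A x L"
proof
  assume *: "A L x \<in> blocked A x L"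
  let ?B = "alg_bin A L (A L x)"
  have B: "?B \<noteq> []"
    using * by (simp add: blocked_def alg_bin_eq_Nil_iff)
  have "level (?B @ [x]) \<le> 1" "distinct_adj (map item_color (?B @ [x]))"
    using alg_bin_valid[OF assms, of "A L x"] by (auto simp: alg_bin_snoc)
  with * B show False
    by (auto simp: blocked_def distinct_adj_append_iff last_map)
qed

text \<open>The bin that accepts \<open>x\<close> was not blocked and becomes so, since
  \<open>x\<close> now tops it; the blocked bins do not receive \<open>x\<close> and stay as they
  are.\<close>

lemma card_blocked_snoc:
  assumes "online_algorithm C A" "is_instance C (L @ [x])"
  shows "Suc (card (blocked A x L)) \<le> card (blocked A x (L @ [x]))"
proof -
  have "insert (A L x) (blocked A x L) \<subseteq> blocked A x (L @ [x])"
    using blocked_not_used[OF assms] by (auto simp: blocked_def alg_bin_snoc set_run_snoc)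
  from card_mono[OF _ this] show ?thesis
    using blocked_not_used[OF assms] by simp
qed

lemma card_blocked_replicate:
  assumes "online_algorithm C A" "is_instance C L" "is_instance C [x]"
  shows "card (blocked A x L) + n \<le> card (blocked A x (L @ replicate n x))"
proof (induction n)
  case (Suc n)
  have "is_instance C ((L @ replicate n x) @ [x])"
    using assms by (auto simp: is_instance_def)
  from card_blocked_snoc[OF assms(1) this] Suc show ?case
    by (simp add: replicate_append_same)
qed simp

section \<open>Pairs of separators and the offline packing\<close>

text \<open>Any selection of whole pairs, kept in order, alternates in color if \<open>e\<close> and
  \<open>f\<close> differ. Hence it may share a single bin, and one pair can separate two items of a
  third color.\<close>

definition pairs :: "'c \<Rightarrow> 'c \<Rightarrow> (real \<times> real) list \<Rightarrow> 'c item list" where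
  "pairs e f ps = concat (map (\<lambda>(u, v). [(u, e), (v, f)]) ps)"

lemma pairs_simps [simp]:
  "pairs e f [] = []"
  "pairs e f ((u, v) # ps) = (u, e) # (v, f) # pairs e f ps"
  "pairs e f (ps @ qs) = pairs e f ps @ pairs e f qs"
  by (simp_all add: pairs_def)

lemma set_pairs: "x \<in> set (pairs e f ps) \<Longrightarrow> \<exists>(u, v) \<in> set ps. x = (u, e) \<or> x = (v, f)"
  by (induction ps) auto

lemma distinct_adj_pairs:
  assumes "e \<noteq> f"
  shows "distinct_adj (map item_color (pairs e f ps))"
proof (induction ps)
  case (Cons p ps)
  then show ?case using assms by (cases p; cases ps) auto
qed simp

lemma level_pairs_le:
  assumes "\<And>u v. (u, v) \<in> set ps \<Longrightarrow> u \<le> h \<and> v \<le> h"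
  shows "level (pairs e f ps) \<le> 2 * h * real (length ps)"
  using assms
proof (induction ps)
  case (Cons p ps)
  obtain u v where p: "p = (u, v)" by (cases p)
  have "u \<le> h" "v \<le> h" "level (pairs e f ps) \<le> 2 * h * real (length ps)"
    using Cons p by auto
  then show ?case by (simp add: p algebra_simps)
qed simp

text \<open>The offline packing never splits a pair, so one label per pair describes it.\<close>

definition dup :: "packing \<Rightarrow> packing" where
  "dup ls = concat (map (\<lambda>l. [l, l]) ls)"

lemma set_dup [simp]: "set (dup ls) = set ls"
  by (auto simp: dup_def)

lemma length_dup: "length ls = length ps \<Longrightarrow> length (dup ls) = length (pairs e f ps)"
  by (induction ls ps rule: list_induct2) (auto simp: dup_def)

text \<open>On the right-hand side, the pair of sizes \<open>(u, v)\<close> is read as an item of size \<open>u\<close> and color \<open>v\<close>.\<close>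

lemma bin_contents_pairs:
  assumes "length ls = length ps"
  shows "bin_contents (pairs e f ps) (dup ls) b = pairs e f (bin_contents ps ls b)"
  using assms by (induction ls ps rule: list_induct2) (auto simp: dup_def)

lemma bin_contents_replicate:
  "bin_contents (replicate n x) [0..<n] b = (if b < n then [x] else [])"
proof (induction n)
  case (Suc n)
  have "bin_contents (replicate n x @ [x]) ([0..<n] @ [n]) b = (if b < Suc n then [x] else [])"
    using Suc by (subst bin_contents_append) auto
  then show ?case by (simp add: replicate_append_same)
qed simp

text \<open>Scanning from the right, each element satisfying \<open>P\<close> takes the highest bin
  below \<open>n\<close> that is still free; all other elements go to the collecting bin
  \<open>g\<close>, which \<open>n \<le> g\<close> keeps apart from these bins.\<close>

lemma labels_exist:
  fixes xs :: "'c item list"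
  assumes "n \<le> length (filter P xs)" "n \<le> g"
  shows "\<exists>ls. length ls = length xs \<and> set ls \<subseteq> {..<n} \<union> {g} \<and>
           (\<forall>b<n. \<exists>x. P x \<and> bin_contents xs ls b = [x])"
  using assms
proof (induction xs arbitrary: n rule: rev_induct)
  case Nil
  then show ?case by simp
next
  case (snoc x xs)
  show ?case
  proof (cases "P x \<and> n > 0")
    case True
    then obtain k where n: "n = Suc k" by (cases n) auto
    with snoc.prems True have "k \<le> length (filter P xs)" "k \<le> g" by auto
    from snoc.IH[OF this] obtain ls where ls: "length ls = length xs" "set ls \<subseteq> {..<k} \<union> {g}"
      "\<forall>b<k. \<exists>x. P x \<and> bin_contents xs ls b = [x]" by blast
    have "bin_contents xs ls k = []"
      using ls snoc.prems n by (subst bin_contents_eq_Nil_iff) auto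
    then show ?thesis
      using ls True n
      by (intro exI[of _ "ls @ [k]"]) (auto simp: bin_contents_append less_Suc_eq simp del: split_paired_Ex)
  next
    case False
    with snoc.prems have "n \<le> length (filter P xs)" "n \<le> g" by (auto split: if_splits)
    from snoc.IH[OF this] obtain ls where ls: "length ls = length xs" "set ls \<subseteq> {..<n} \<union> {g}"
      "\<forall>b<n. \<exists>x. P x \<and> bin_contents xs ls b = [x]" by blast
    then show ?thesis
      using snoc.prems by (intro exI[of _ "ls @ [g]"]) (auto simp: bin_contents_append)
  qed
qed

text \<open>The first \<open>n\<close> bins are those that the final items are to enter. Empty ones
  are allowed so that the empty packing qualifies before the first round; the label \<open>m\<close>
  is always fresh.\<close>

definition uniform_packing :: "'c item list \<Rightarrow> packing \<Rightarrow> nat \<Rightarrow> nat \<Rightarrow> 'c \<Rightarrow> bool" where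
  "uniform_packing L p n m d \<longleftrightarrow> valid_packing L p \<and> set p \<subseteq> {..<m} \<and>
     (\<forall>b<n. bin_contents L p b = [] \<or> item_color (last (bin_contents L p b)) = d)"

text \<open>A round costs the one new bin \<open>m\<close>. If \<open>c\<close> differs from the old
  top \<open>d\<close>, all pairs go to bin \<open>m\<close> and the items of color \<open>c\<close>
  go directly onto the \<open>n\<close> bins. If \<open>c = d\<close>, each of these bins first
  receives a pair that leaves room for size \<open>s\<close>, and the remaining pairs go to bin
  \<open>m\<close>.\<close>

lemma uniform_packing_extend:
  assumes up: "uniform_packing L p n m d" and nm: "n \<le> m"
    and zero: "\<And>x. x \<in> set L \<Longrightarrow> item_size x = 0"
    and col: "e \<noteq> f" "e \<noteq> d" "f \<noteq> d"
    and s: "s \<le> 1"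
    and ps: "\<And>u v. (u, v) \<in> set ps \<Longrightarrow> u \<le> h \<and> v \<le> h" "0 \<le> h" "2 * h * real (length ps) \<le> 1"
    and hide: "c = d \<Longrightarrow> n \<le> length (filter (\<lambda>(u, v). u + v + s \<le> 1) ps)"
  shows "\<exists>p'. uniform_packing (L @ pairs e f ps @ replicate n (s, c)) p' n (Suc m) c"
proof -
  have "\<exists>ls. length ls = length ps \<and> set ls \<subseteq> {..<n} \<union> {m} \<and>
      (\<forall>b<n. if c = d then \<exists>u v. u + v + s \<le> 1 \<and> bin_contents ps ls b = [(u, v)]
             else bin_contents ps ls b = [])"
  proof (cases "c = d")
    case True
    from labels_exist[OF hide[OF True] nm] True show ?thesis by auto
  next
    case False
    with nm show ?thesis
      by (intro exI[of _ "replicate (length ps) m"]) (auto simp: bin_contents_eq_Nil_iff)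
  qed
  then obtain ls where ls: "length ls = length ps" "set ls \<subseteq> {..<n} \<union> {m}"
    and main: "\<And>b. b < n \<Longrightarrow> if c = d then \<exists>u v. u + v + s \<le> 1 \<and> bin_contents ps ls b = [(u, v)]
             else bin_contents ps ls b = []" by blast
  define L' where "L' = L @ pairs e f ps @ replicate n (s, c)"
  define p' where "p' = p @ dup ls @ [0..<n]"
  have len: "length p = length L" and p: "set p \<subseteq> {..<m}"
    and adj: "\<And>b. distinct_adj (map item_color (bin_contents L p b))"
    and top: "\<And>b. b < n \<Longrightarrow> bin_contents L p b = [] \<or> item_color (last (bin_contents L p b)) = d"
    using up by (auto simp: uniform_packing_def valid_packing_def)
  have lev: "level (bin_contents L p b) = 0" for b
  proof -
    have "map item_size (bin_contents L p b) = map (\<lambda>_. 0) (bin_contents L p b)"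
      using set_bin_contents[of L p b] zero by (intro map_cong) auto
    then show ?thesis by (simp only: sum_list_0)
  qed
  have cont: "bin_contents L' p' b =
      bin_contents L p b @ pairs e f (bin_contents ps ls b) @ (if b < n then [(s, c)] else [])" for b
    unfolding L'_def p'_def using len length_dup[OF ls(1), of e f]
    by (simp add: bin_contents_append bin_contents_pairs[OF ls(1)] bin_contents_replicate)
  \<comment> \<open>Bins below \<open>n\<close> get at most one pair and one item of size
    \<open>s\<close> on top of contents of size zero; bin \<open>m\<close> holds only pairs, of
    total size at most \<open>2 * h * length ps\<close>; the other bins do not change.\<close>
  have "level (bin_contents L' p' b) \<le> 1 \<and> distinct_adj (map item_color (bin_contents L' p' b))" for b
  proof (cases "b < n")
    case True
    from main[OF True] top[OF True] show ?thesis
      using True adj[of b] lev[of b] s col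
      by (auto simp: cont distinct_adj_append_iff last_map split: if_splits)
  next
    case False
    show ?thesis
    proof (cases "b = m")
      case True
      then have "bin_contents L p b = []"
        using p len by (subst bin_contents_eq_Nil_iff) auto
      moreover have "level (pairs e f (bin_contents ps ls b)) \<le> 1"
      proof -
        have "level (pairs e f (bin_contents ps ls b)) \<le> 2 * h * real (length (bin_contents ps ls b))"
          using ps(1) set_bin_contents[of ps ls b] by (intro level_pairs_le) blast
        also have "\<dots> \<le> 2 * h * real (length ps)"
          using length_bin_contents[of ps ls b] ps(2) by (intro mult_left_mono) auto
        finally show ?thesis using ps(3) by simp
      qed
      ultimately show ?thesis
        using False distinct_adj_pairs[OF col(1)] by (simp add: cont)
    next
      case False
      then have "bin_contents ps ls b = []"
        using ls \<open>\<not> b < n\<close> by (subst bin_contents_eq_Nil_iff) auto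
      then show ?thesis using adj[of b] lev[of b] \<open>\<not> b < n\<close> by (simp add: cont)
    qed
  qed
  moreover have "length p' = length L'"
    using len length_dup[OF ls(1), of e f] by (simp add: p'_def L'_def)
  moreover have "set p' \<subseteq> {..<Suc m}"
    using p ls(2) nm by (auto simp: p'_def)
  ultimately have "uniform_packing L' p' n (Suc m) c"
    by (auto simp: uniform_packing_def valid_packing_def cont)
  then show ?thesis unfolding L'_def by blast
qed

section \<open>Rounds of items of size zero\<close>

lemma card_3_obtain_others:
  assumes "card T = 3" "d \<in> T"
  obtains e f where "T = {d, e, f}" "e \<noteq> f" "e \<noteq> d" "f \<noteq> d"
proof -
  have "card (T - {d}) = 2"
    using assms by simp
  then obtain e f where "T - {d} = {e, f}" "e \<noteq> f"
    by (auto simp: card_2_iff)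
  with assms(2) that[of e f] show ?thesis by blast
qed

text \<open>Pigeonhole: every bin in use is topped by one of three colors, so the three blocked sets
  cover all of them.\<close>

lemma popular_top:
  assumes "card T = 3" "set (map item_color L) \<subseteq> T"
  shows "\<exists>c\<in>T. ALG A L \<le> 3 * card (blocked A (0, c) L)"
proof (rule ccontr)
  assume "\<not> ?thesis"
  then have *: "3 * card (blocked A (0, c) L) < ALG A L" if "c \<in> T" for c
    using that by auto
  have T: "finite T" "T \<noteq> {}"
    using assms(1) by (auto intro: card_ge_0_finite)
  have "b \<in> (\<Union>c\<in>T. blocked A (0, c) L)" if "b \<in> set (run A L)" for b
  proof -
    have "last (alg_bin A L b) \<in> set (alg_bin A L b)"
      using that by (simp add: alg_bin_eq_Nil_iff)
    then have "item_color (last (alg_bin A L b)) \<in> T"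
      using set_bin_contents[of L "run A L" b] assms(2) by auto
    then show ?thesis using that by (auto simp: blocked_def)
  qed
  then have "ALG A L \<le> card (\<Union>c\<in>T. blocked A (0, c) L)"
    unfolding ALG_def num_bins_def using T(1) by (intro card_mono) auto
  also have "\<dots> \<le> (\<Sum>c\<in>T. card (blocked A (0, c) L))"
    using T(1) by (rule card_UN_le)
  finally have "3 * ALG A L \<le> (\<Sum>c\<in>T. 3 * card (blocked A (0, c) L))"
    by (simp add: sum_distrib_left [symmetric])
  also have "\<dots> < (\<Sum>c\<in>T. ALG A L)"
    using T * by (intro sum_strict_mono) auto
  also have "\<dots> = 3 * ALG A L"
    using assms(1) by simp
  finally show False by simp
qed

lemma ALG_append: "ALG A L \<le> ALG A (L @ L')"
  unfolding ALG_def num_bins_def by (intro card_mono set_run_append) simp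

text \<open>From \<open>b\<close> bins topped by one color, a round leads to at least
  \<open>n + b / 3\<close>. Iterated from 0, this recurrence gives
  \<open>3 / 2 * (1 - (1 / 3) ^ k) * n\<close>, which tends to its fixed point
  \<open>3 / 2 * n\<close>.\<close>

lemma zero_size_rounds:
  assumes A: "online_algorithm C A" and T: "T \<subseteq> C" "card T = 3"
  shows "\<exists>L d p. set L \<subseteq> {0} \<times> T \<and> d \<in> T \<and> uniform_packing L p n (n + k) d \<and>
           3 / 2 * (1 - (1 / 3) ^ k) * real n \<le> real (card (blocked A (0, d) L))"
proof (induction k)
  case 0
  obtain d where "d \<in> T" using T(2) by fastforce
  then show ?case
    by (intro exI[of _ "[]"] exI[of _ d]) (auto simp: uniform_packing_def valid_packing_def)
next
  case (Suc k)
  then obtain L d p where L: "set L \<subseteq> {0} \<times> T" and d: "d \<in> T"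
    and up: "uniform_packing L p n (n + k) d"
    and ineq: "3 / 2 * (1 - (1 / 3) ^ k) * real n \<le> real (card (blocked A (0, d) L))" by blast
  obtain e f where ef: "T = {d, e, f}" "e \<noteq> f" "e \<noteq> d" "f \<noteq> d"
    using card_3_obtain_others[OF T(2) d] .
  \<comment> \<open>The color \<open>c\<close> is chosen only after the algorithm has packed these
    pairs; \<open>n\<close> of them suffice to hide all tops should \<open>c = d\<close>
    occur.\<close>
  define L' where "L' = L @ pairs e f (replicate n (0, 0))"
  have L': "set L' \<subseteq> {0} \<times> T"
    using L ef(1) by (auto simp: L'_def dest!: set_pairs)
  obtain c where c: "c \<in> T" "ALG A L' \<le> 3 * card (blocked A (0, c) L')"
    using popular_top[OF T(2), of L' A] L' by fastforce
  define L'' where "L'' = L' @ replicate n (0, c)"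
  \<comment> \<open>The bins blocked before this round are still among the algorithm's bins, at
    least a third of which are now blocked for \<open>c\<close>.\<close>
  have "card (blocked A (0, d) L) \<le> 3 * card (blocked A (0, c) L')"
    using card_blocked_le_ALG[of A "(0, d)" L] ALG_append[of A L] c(2)
    unfolding L'_def by (meson order_trans)
  moreover have "card (blocked A (0, c) L') + n \<le> card (blocked A (0, c) L'')"
    unfolding L''_def
    by (rule card_blocked_replicate[OF A]) (use L' c(1) T(1) in \<open>auto simp: is_instance_def\<close>)
  ultimately have "card (blocked A (0, d) L) + 3 * n \<le> 3 * card (blocked A (0, c) L'')"
    by linarith
  then have "real (card (blocked A (0, d) L)) + 3 * real n \<le> 3 * real (card (blocked A (0, c) L''))"
    by linarith
  with ineq have "3 / 2 * (1 - (1 / 3) ^ Suc k) * real n \<le> real (card (blocked A (0, c) L''))"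
    by (simp add: algebra_simps)
  moreover have "\<exists>p'. uniform_packing L'' p' n (Suc (n + k)) c"
    unfolding L''_def L'_def append_assoc
    by (rule uniform_packing_extend[OF up, where h = 0]) (use L ef in auto)
  moreover have "set L'' \<subseteq> {0} \<times> T"
    using L' c(1) by (auto simp: L''_def)
  ultimately show ?case using c(1) by auto
qed

section \<open>Adaptively chosen sizes\<close>

definition touched :: "'c algorithm \<Rightarrow> 'c item list \<Rightarrow> 'c item list \<Rightarrow> nat set" where
  "touched A L X = {b. alg_bin A (L @ X) b \<noteq> alg_bin A L b}"

lemma touched_Nil [simp]: "touched A L [] = {}"
  by (simp add: touched_def)

lemma alg_bin_append: "\<exists>Y. alg_bin A (L @ X) b = alg_bin A L b @ Y"
proof (induction X rule: rev_induct)
  case (snoc x X)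
  then show ?case using alg_bin_snoc[of "L @ X" x A b] by auto
qed auto

lemma touched_snoc: "touched A L (X @ [x]) = insert (A (L @ X) x) (touched A L X)"
proof -
  have "alg_bin A (L @ X @ [x]) b = alg_bin A L b \<longleftrightarrow>
      alg_bin A (L @ X) b = alg_bin A L b \<and> A (L @ X) x \<noteq> b" for b
    using alg_bin_append[of L X A b] alg_bin_snoc[of "L @ X" x A b] by auto
  then show ?thesis by (auto simp: touched_def)
qed

lemma touched_subset: "touched A L X \<subseteq> set (run A (L @ X))"
proof (induction X rule: rev_induct)
  case (snoc x X)
  then show ?case using run_snoc[of A "L @ X" x] by (auto simp: touched_snoc)
qed simp

lemma finite_touched [simp]: "finite (touched A L X)"
  by (rule finite_subset[OF touched_subset]) simp

text \<open>Invariant of an adversary that narrows a gap between small sizes (up to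
  \<open>lo\<close>) and large ones (from \<open>hi\<close> on). An item is meant to end up large
  exactly if it is the first of \<open>X\<close> in its bin; the last two conditions record what is
  needed of this.\<close>

definition separated :: "'c algorithm \<Rightarrow> 'c item list \<Rightarrow> 'c item list \<Rightarrow> real \<Rightarrow> real \<Rightarrow> real \<Rightarrow> bool" where
  "separated A L X h lo hi \<longleftrightarrow> 0 < lo \<and> hi \<le> h \<and>
     (\<forall>x\<in>set X. 0 < item_size x \<and> item_size x \<le> h \<and> (item_size x \<le> lo \<or> hi \<le> item_size x)) \<and>
     (\<forall>b\<in>touched A L X. hi \<le> level (alg_bin A (L @ X) b)) \<and>
     length (filter (\<lambda>x. lo < item_size x) X) \<le> card (touched A L X)"

text \<open>The size \<open>lo * B\<close> lies inside the gap and is classified only after the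
  algorithm's decision: if the bin was touched already, \<open>lo\<close> rises to it and the item
  is small; otherwise \<open>hi\<close> drops to it and the item is large. Either way a gap of ratio
  \<open>B * B\<close> leaves one of ratio \<open>B\<close>.\<close>

lemma separated_step:
  assumes sep: "separated A L X h lo hi" and inst: "is_instance C L" and B: "1 < B" and gap: "lo * (B * B) \<le> hi"
  shows "\<exists>s lo' hi'. separated A L (X @ [(s, c)]) h lo' hi' \<and> lo' * B \<le> hi'"
proof -
  define s where "s = lo * B"
  define x where "x = (s, c)"
  have lo: "0 < lo" and hi: "hi \<le> h"
    and X: "\<And>y. y \<in> set X \<Longrightarrow> 0 < fst y \<and> fst y \<le> h \<and> (fst y \<le> lo \<or> hi \<le> fst y)"
    and lev: "\<And>b. b \<in> touched A L X \<Longrightarrow> hi \<le> level (alg_bin A (L @ X) b)"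
    and cnt: "length (filter (\<lambda>x. lo < item_size x) X) \<le> card (touched A L X)"
    using sep by (auto simp: separated_def)
  have s: "lo < s" "s * B \<le> hi"
    using lo B gap by (auto simp: s_def mult.assoc)
  have "s < s * B"
    using s(1) lo B by simp
  then have shi: "s < hi" using s(2) by linarith
  have bin: "alg_bin A (L @ X @ [x]) b = alg_bin A (L @ X) b @ (if A (L @ X) x = b then [x] else [])" for b
    using alg_bin_snoc[of "L @ X" x A b] by simp
  show ?thesis
  proof (cases "A (L @ X) x \<in> touched A L X")
    case True
    \<comment> \<open>No size in \<open>X\<close> lies strictly between \<open>lo\<close> and
      \<open>hi\<close>, so raising the threshold to \<open>s < hi\<close> reclassifies
      nothing.\<close>
    have "filter (\<lambda>y. s < fst y) X = filter (\<lambda>y. lo < fst y) X"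
      by (rule filter_cong[OF refl]) (use X s shi in fastforce)
    then have "separated A L (X @ [x]) h s hi"
      unfolding separated_def touched_snoc insert_absorb[OF True] bin
    proof (intro conjI ballI)
      fix b assume "b \<in> touched A L X"
      from lev[OF this] show "hi \<le> level (alg_bin A (L @ X) b @ (if A (L @ X) x = b then [x] else []))"
        using s(1) lo by (simp add: x_def)
    next
      fix y assume "y \<in> set (X @ [x])"
      then consider "y \<in> set X" | "y = x" by auto
      then show "0 < fst y" "fst y \<le> h" "fst y \<le> s \<or> hi \<le> fst y"
        using X[of y] lo s hi shi by (cases; force simp: x_def)+
    qed (use lo hi s cnt in \<open>auto simp: x_def\<close>)
    then show ?thesis using s(2) unfolding x_def by blast
  next
    case False
    then have "alg_bin A (L @ X) (A (L @ X) x) = alg_bin A L (A (L @ X) x)"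
      by (simp add: touched_def)
    then have new: "0 \<le> level (alg_bin A (L @ X) (A (L @ X) x))"
      using level_alg_bin_nonneg[OF inst] by simp
    have "separated A L (X @ [x]) h lo s"
      unfolding separated_def touched_snoc bin
    proof (intro conjI ballI)
      fix b assume "b \<in> insert (A (L @ X) x) (touched A L X)"
      then show "s \<le> level (alg_bin A (L @ X) b @ (if A (L @ X) x = b then [x] else []))"
        using lev[of b] new shi False by (auto simp: x_def)
    next
      fix y assume "y \<in> set (X @ [x])"
      then consider "y \<in> set X" | "y = x" by auto
      then show "0 < fst y" "fst y \<le> h" "fst y \<le> lo \<or> s \<le> fst y"
        using X[of y] lo s hi shi by (cases; force simp: x_def)+
    qed (use lo hi s shi cnt False in \<open>auto simp: x_def\<close>)
    then show ?thesis unfolding x_def s_def by blast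
  qed
qed

text \<open>Each item takes the square root of the guaranteed gap ratio, so a pair needs the fourth
  power of \<open>B\<close> before it to leave \<open>B\<close> after it. Hence the induction runs
  over arbitrary \<open>B\<close>.\<close>

lemma separated_pairs:
  assumes inst: "is_instance C L" and h: "0 < h" and B: "1 < B"
  shows "\<exists>ps lo hi. length ps = k \<and> separated A L (pairs e f ps) h lo hi \<and> lo * B \<le> hi"
  using B
proof (induction k arbitrary: B)
  case 0
  then show ?case
    using h by (intro exI[of _ "[]"] exI[of _ "h / B"] exI[of _ h]) (auto simp: separated_def)
next
  case (Suc k)
  have B: "1 < B" "1 < B * B" "1 < (B * B) * (B * B)"
    using Suc.prems by (auto intro!: less_1_mult)
  from Suc.IH[OF B(3)] obtain ps lo hi where
    ps: "length ps = k" "separated A L (pairs e f ps) h lo hi" "lo * ((B * B) * (B * B)) \<le> hi" by blast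
  from separated_step[OF ps(2) inst B(2) ps(3), of e] obtain u lo' hi' where
    u: "separated A L (pairs e f ps @ [(u, e)]) h lo' hi'" "lo' * (B * B) \<le> hi'" by blast
  from separated_step[OF u(1) inst B(1) u(2), of f] obtain v lo'' hi'' where
    v: "separated A L ((pairs e f ps @ [(u, e)]) @ [(v, f)]) h lo'' hi''" "lo'' * B \<le> hi''" by blast
  have "separated A L (pairs e f (ps @ [(u, v)])) h lo'' hi''"
    using v(1) by simp
  then show ?case using ps(1) v(2) by (metis length_append_singleton)
qed

text \<open>A pair that is not small contributes at least one item larger than \<open>t\<close>, and
  different pairs contribute different occurrences.\<close>

lemma length_le_small_pairs:
  "length ps \<le> length (filter (\<lambda>(u, v). u \<le> t \<and> v \<le> t) ps)
     + length (filter (\<lambda>x. t < item_size x) (pairs e f ps))"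
proof (induction ps)
  case (Cons p ps)
  obtain u v where "p = (u, v)" by (cases p)
  with Cons show ?case by auto
qed simp

section \<open>The lower bound\<close>

text \<open>If the algorithm touches \<open>3 * n\<close> bins in the last round, it has lost
  already. Otherwise large items are few, enough small pairs remain to hide the offline tops, and
  \<open>n\<close> huge items of color \<open>d\<close> find all bins topped by \<open>d\<close>
  before the round blocked.\<close>

lemma bad_instance:
  assumes A: "online_algorithm C A" and T: "T \<subseteq> C" "card T = 3" and n: "0 < n"
  shows "\<exists>L. is_instance C L \<and> OPT L \<le> n + k + 1 \<and>
           (5 / 2 - 3 / 2 * (1 / 3) ^ k) * real n \<le> real (ALG A L)"
proof -
  obtain L d p where L: "set L \<subseteq> {0} \<times> T" and d: "d \<in> T"
    and up: "uniform_packing L p n (n + k) d"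
    and ineq: "3 / 2 * (1 - (1 / 3) ^ k) * real n \<le> real (card (blocked A (0, d) L))"
    using zero_size_rounds[OF A T, where n = n and k = k] by blast
  obtain e f where ef: "T = {d, e, f}" "e \<noteq> f" "e \<noteq> d" "f \<noteq> d"
    using card_3_obtain_others[OF T(2) d] .
  have L_inst: "is_instance C L"
    using L T(1) by (auto simp: is_instance_def)
  \<comment> \<open>Chosen so that \<open>4 * n\<close> pairs of items of size at most
    \<open>h\<close> fit into one bin.\<close>
  define h where "h = 1 / (8 * real n)"
  have h: "0 < h" "2 * h \<le> 1" "2 * h * real (4 * n) \<le> 1"
    using n by (auto simp: h_def field_simps)
  \<comment> \<open>With fewer than \<open>3 * n\<close> large items, at least \<open>n\<close> of
    \<open>4 * n\<close> pairs are small. The ratio 3 ensures \<open>2 * lo < hi\<close>.\<close>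
  obtain ps lo hi where ps: "length ps = 4 * n" and sep: "separated A L (pairs e f ps) h lo hi"
    and gap: "lo * 3 \<le> hi"
    using separated_pairs[OF L_inst h(1), of 3 "4 * n" A e f] by auto
  define X where "X = pairs e f ps"
  have lo: "0 < lo" "lo * 3 \<le> h" using sep gap by (auto simp: separated_def)
  have X_le: "0 < item_size x \<and> item_size x \<le> h" if "x \<in> set X" for x
    using sep that by (auto simp: separated_def X_def)
  have ps_le: "u \<le> h \<and> v \<le> h" if "(u, v) \<in> set ps" for u v
  proof -
    have "(u, e) \<in> set X" "(v, f) \<in> set X"
      using that by (auto simp: X_def pairs_def)
    then show ?thesis using X_le by fastforce
  qed
  have X_inst: "is_instance C X"
    using X_le h(2) ef(1) T(1) unfolding is_instance_def X_def
    by (fastforce dest: set_pairs)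
  have extend: "OPT (L @ X @ replicate n (s, c)) \<le> n + k + 1"
    if "s \<le> 1" "c = d \<Longrightarrow> n \<le> length (filter (\<lambda>(u, v). u + v + s \<le> 1) ps)" for s c
  proof -
    have "\<exists>p'. uniform_packing (L @ X @ replicate n (s, c)) p' n (Suc (n + k)) c"
      unfolding X_def
      by (rule uniform_packing_extend[OF up, where h = h])
        (use L ef h ps ps_le that in \<open>auto simp: mult.assoc\<close>)
    then show ?thesis using OPT_le by (fastforce simp: uniform_packing_def)
  qed
  show ?thesis
  proof (cases "3 * n \<le> card (touched A L X)")
    case True
    \<comment> \<open>The items of color \<open>e\<close> complete the round in the form that
      \<open>extend\<close> handles; as \<open>e \<noteq> d\<close>, no top has to be
      hidden.\<close>
    let ?L = "L @ X @ replicate n (0, e)"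
    have "card (touched A L X) \<le> ALG A (L @ X)"
      unfolding ALG_def num_bins_def by (intro card_mono touched_subset) simp
    also have "\<dots> \<le> ALG A ?L"
      using ALG_append[of A "L @ X"] by simp
    finally have "3 * real n \<le> real (ALG A ?L)" using True by linarith
    moreover have "(5 / 2 - 3 / 2 * (1 / 3) ^ k) * real n \<le> 3 * real n"
      by (intro mult_right_mono) (auto intro: order_trans[of _ "5 / 2"])
    moreover have "is_instance C ?L"
      using L_inst X_inst ef(1) T(1) by (auto simp: is_instance_def)
    ultimately show ?thesis using extend[of 0 e] ef(3) by (intro exI[of _ ?L]) auto
  next
    case False
    \<comment> \<open>The largest size that still fits with any pair of items of size at most
      \<open>lo\<close>.\<close>
    let ?x = "(1 - 2 * lo, d)"
    let ?L = "L @ X @ replicate n ?x"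
    have x_inst: "is_instance C [?x]"
      using lo h(2) d T(1) by (auto simp: is_instance_def)
    have "length (filter (\<lambda>x. lo < item_size x) X) \<le> card (touched A L X)"
      using sep by (simp add: separated_def X_def)
    then have "n \<le> length (filter (\<lambda>(u, v). u \<le> lo \<and> v \<le> lo) ps)"
      using length_le_small_pairs[of ps lo e f] False ps by (simp add: X_def)
    also have "\<dots> \<le> length (filter (\<lambda>(u, v). u + v + (1 - 2 * lo) \<le> 1) ps)"
      by (induction ps) auto
    finally have opt: "OPT ?L \<le> n + k + 1"
      using lo by (intro extend) auto
    \<comment> \<open>A touched bin has level at least \<open>hi > 2 * lo\<close> and is too full
      for \<open>?x\<close>; an untouched one is still topped by \<open>d\<close>.\<close>
    have "blocked A (0, d) L \<subseteq> blocked A ?x (L @ X)"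
    proof
      fix b assume b: "b \<in> blocked A (0, d) L"
      then have "b \<in> set (run A (L @ X))"
        using set_run_append[of A L X] by (auto simp: blocked_def)
      moreover have "item_color (last (alg_bin A L b)) = d"
        using b alg_bin_valid(1)[OF A L_inst, of b] by (auto simp: blocked_def)
      moreover have "2 * lo < level (alg_bin A (L @ X) b)" if "b \<in> touched A L X"
        using sep that gap lo by (fastforce simp: separated_def X_def)
      ultimately show "b \<in> blocked A ?x (L @ X)"
        by (cases "b \<in> touched A L X") (auto simp: blocked_def touched_def)
    qed
    then have "card (blocked A (0, d) L) + n \<le> card (blocked A ?x (L @ X)) + n"
      by (simp add: card_mono)
    also have "\<dots> \<le> card (blocked A ?x ((L @ X) @ replicate n ?x))"
      by (rule card_blocked_replicate[OF A]) (use L_inst X_inst x_inst in auto)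
    also have "\<dots> \<le> ALG A ?L"
      using card_blocked_le_ALG[of A ?x ?L] by simp
    finally have "real (card (blocked A (0, d) L)) + real n \<le> real (ALG A ?L)"
      by linarith
    with ineq have "(5 / 2 - 3 / 2 * (1 / 3) ^ k) * real n \<le> real (ALG A ?L)"
      by (simp add: algebra_simps)
    moreover have "is_instance C ?L"
      using L_inst X_inst x_inst by (auto simp: is_instance_def)
    ultimately show ?thesis using opt by blast
  qed
qed

text \<open>The finitely many values before the little-o bound sets in are absorbed into
  \<open>K\<close>. A bound for all \<open>m\<close> is wanted because the bad instances come only
  with an upper bound on \<open>OPT\<close>.\<close>

lemma smallo_nat_linear_bound:
  fixes g :: "nat \<Rightarrow> real"
  assumes "g \<in> o(\<lambda>n. real n)" "0 < \<epsilon>"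
  shows "\<exists>K. \<forall>m. g m \<le> \<epsilon> * real m + K"
proof -
  from landau_o.smallD[OF assms] obtain N where N: "\<And>m. m \<ge> N \<Longrightarrow> \<bar>g m\<bar> \<le> \<epsilon> * real m"
    by (auto simp: eventually_sequentially)
  have "g m \<le> \<epsilon> * real m + (\<Sum>i<N. \<bar>g i\<bar>)" for m
  proof (cases "m < N")
    case True
    then have "\<bar>g m\<bar> \<le> (\<Sum>i<N. \<bar>g i\<bar>)"
      by (intro member_le_sum) auto
    moreover have "0 \<le> \<epsilon> * real m" using assms(2) by simp
    ultimately show ?thesis by linarith
  next
    case False
    then have "\<bar>g m\<bar> \<le> \<epsilon> * real m" using N by simp
    moreover have "0 \<le> (\<Sum>i<N. \<bar>g i\<bar>)" by (simp add: sum_nonneg)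
    ultimately show ?thesis by linarith
  qed
  then show ?thesis by blast
qed

lemma asymptotically_competitive_ge:
  assumes A: "online_algorithm C A" and T: "T \<subseteq> C" "card T = 3"
    and comp: "asymptotically_competitive C A r"
  shows "5 / 2 \<le> r"
proof (rule ccontr)
  assume "\<not> 5 / 2 \<le> r"
  \<comment> \<open>A nonnegative factor allows \<open>OPT L\<close> to be replaced by its upper
    bound.\<close>
  define q where "q = max r 0"
  \<comment> \<open>Of the distance \<open>3 * \<epsilon>\<close> between \<open>q\<close> and
    \<open>5 / 2\<close>, one \<open>\<epsilon>\<close> pays for stopping after \<open>k\<close>
    rounds, one for \<open>g\<close>, and a quarter for the additive terms;
    \<open>3 / 4 * \<epsilon>\<close> is left for the contradiction.\<close>
  define \<epsilon> where "\<epsilon> = (5 / 2 - q) / 3"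
  have q: "0 \<le> q" "r \<le> q" "q = 5 / 2 - 3 * \<epsilon>"
    by (simp_all add: q_def \<epsilon>_def field_simps)
  have \<epsilon>: "0 < \<epsilon>"
    using \<open>\<not> 5 / 2 \<le> r\<close> by (simp add: q_def \<epsilon>_def)
  obtain g where g: "g \<in> o(\<lambda>n. real n)"
    and alg: "\<And>L. is_instance C L \<Longrightarrow> real (ALG A L) \<le> r * real (OPT L) + g (OPT L)"
    using comp by (auto simp: asymptotically_competitive_def)
  obtain K where K: "\<And>m. g m \<le> \<epsilon> * real m + K"
    using smallo_nat_linear_bound[OF g \<epsilon>] by blast
  obtain k where k: "(1 / 3 :: real) ^ k < 2 / 3 * \<epsilon>"
    using real_arch_pow_inv[of "2 / 3 * \<epsilon>" "1 / 3"] \<epsilon> by auto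
  \<comment> \<open>\<open>k\<close> and \<open>K\<close> are fixed by now, so a large
    \<open>n\<close> keeps the cost of the \<open>k + 1\<close> extra bins and of \<open>K\<close>
    below \<open>\<epsilon> / 4 * n\<close>.\<close>
  obtain n :: nat where n: "((q + \<epsilon>) * real (k + 1) + \<bar>K\<bar>) / (\<epsilon> / 4) < real n"
    using reals_Archimedean2 by blast
  then have n': "(q + \<epsilon>) * real (k + 1) + \<bar>K\<bar> < \<epsilon> / 4 * real n"
    using \<epsilon> by (simp add: field_simps)
  moreover have "0 \<le> (q + \<epsilon>) * real (k + 1) + \<bar>K\<bar>"
    using q(1) \<epsilon> by simp
  ultimately have "0 < \<epsilon> / 4 * real n" by linarith
  then have n_pos: "0 < n" using \<epsilon> by (simp add: zero_less_mult_iff)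
  obtain L where L: "is_instance C L" "OPT L \<le> n + k + 1"
    and lower: "(5 / 2 - 3 / 2 * (1 / 3) ^ k) * real n \<le> real (ALG A L)"
    using bad_instance[OF A T n_pos] by blast
  have "(5 / 2 - \<epsilon>) * real n \<le> (5 / 2 - 3 / 2 * (1 / 3) ^ k) * real n"
    using k \<epsilon> by (intro mult_right_mono) simp_all
  also note lower
  also have "real (ALG A L) \<le> r * real (OPT L) + g (OPT L)"
    by (rule alg[OF L(1)])
  also have "\<dots> \<le> q * real (OPT L) + (\<epsilon> * real (OPT L) + K)"
    using q(2) K by (intro add_mono mult_right_mono) auto
  also have "\<dots> = (q + \<epsilon>) * real (OPT L) + K"
    by (simp add: algebra_simps)
  also have "\<dots> \<le> (q + \<epsilon>) * real (n + k + 1) + K"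
    using L(2) q(1) \<epsilon> by (intro add_mono mult_left_mono) auto
  also have "\<dots> \<le> (q + \<epsilon>) * real n + ((q + \<epsilon>) * real (k + 1) + \<bar>K\<bar>)"
    by (simp add: algebra_simps)
  also have "\<dots> < (q + \<epsilon>) * real n + \<epsilon> / 4 * real n"
    using n' by simp
  also have "\<dots> = (5 / 2 - 7 / 4 * \<epsilon>) * real n"
    by (simp add: q(3) algebra_simps)
  finally have "(5 / 2 - \<epsilon>) * real n < (5 / 2 - 7 / 4 * \<epsilon>) * real n" .
  then show False
    using \<epsilon> n_pos by (simp add: mult_less_cancel_right)
qed

theorem theorem4p1:
  fixes C :: "'c set"
  assumes "finite C" and "card C \<ge> 3"
  shows "\<not> (\<exists>A :: 'c algorithm. online_algorithm C A \<and> asymptotic_competitive_ratio C A < ereal (5 / 2))"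
proof
  assume "\<exists>A :: 'c algorithm. online_algorithm C A \<and> asymptotic_competitive_ratio C A < ereal (5 / 2)"
  then obtain A :: "'c algorithm" where A: "online_algorithm C A"
    and "asymptotic_competitive_ratio C A < ereal (5 / 2)" by blast
  then obtain r where r: "asymptotically_competitive C A r" "r < 5 / 2"
    by (auto simp: asymptotic_competitive_ratio_def Inf_less_iff)
  obtain T where "T \<subseteq> C" "card T = 3"
    using obtain_subset_with_card_n[OF assms(2)] by blast
  from asymptotically_competitive_ge[OF A this r(1)] r(2) show False by simp
qed

end
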